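(* Let $X$ be a Hausdorff locally convex topological vector space, $e$ an error function on $X\times X$, and $f:X\to\mathbb{R}\cup\{+\infty\}$ a proper and $e$-convex function. Then $$\overline{D}f(x,y-x)+\overline{D}f(y,x-y)\le 2e(x,y)\qquad\text{for all }x,y\in X.$$
   Context: For $f:X\to\mathbb{R}\cup\{+\infty\}$, $\operatorname{dom} f=\{x\in X: f(x)<+\infty\}$; $f$ is proper if $\operatorname{dom} f\ne\emptyset$. An error function is a map $e:X\times X\to\mathbb{R}\cup\{+\infty\}$ that is nonnegative, symmetric, and has nonempty domain $\operatorname{dom} e=\{(x,y): e(x,y)<+\infty\}$. $f$ is called $e$-convex if $\operatorname{dom} f\times\operatorname{dom} f\subset\operatorname{dom} e$ and $f(tx+(1-t)y)\le tf(x)+(1-t)f(y)+t(1-t)e(x,y)$ for all $x,y\in X$ and $t\in\,]0,1[$. The upper Dini directional derivative of $f$ at $x\in X$ in direction $u\in X$ is $\overline{D}f(x,u)=\limsup_{t\to0^+}\frac{f(x+tu)-f(x)}{t}$ if $x\in\operatorname{dom} f$, and $\overline{D}f(x,u)=-\infty$ otherwise. Convention: $(+\infty)+(-\infty)=(-\infty)+(+\infty)=-\infty$. *)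

theory Defs
  imports "HOL-Analysis.Analysis"
begin

class topological_real_vector = real_vector + topological_ab_group_add +
  assumes tendsto_scaleR_Pair:
    "LIM p (nhds c \<times>\<^sub>F nhds a). fst p *\<^sub>R snd p :> nhds (c *\<^sub>R a)"

instance real_normed_vector \<subseteq> topological_real_vector
proof
  fix c :: real and a :: 'a
  have "(fst \<longlongrightarrow> c) (nhds c \<times>\<^sub>F nhds a)"
    by (rule filterlim_fst)
  moreover have "(snd \<longlongrightarrow> a) (nhds c \<times>\<^sub>F nhds a)"
    by (rule filterlim_snd)
  ultimately show "LIM p (nhds c \<times>\<^sub>F nhds a). fst p *\<^sub>R snd p :> nhds (c *\<^sub>R a)"
    by (rule tendsto_scaleR)
qed

(* Functions into the reals extended by +\<infinity> are rendered as functions into ereal that never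
   take the value -\<infinity>. *)

definition eff_dom :: "('b \<Rightarrow> ereal) \<Rightarrow> 'b set" where
  "eff_dom f = {x. f x < \<infinity>}"

definition proper :: "('b \<Rightarrow> ereal) \<Rightarrow> bool" where
  "proper f \<longleftrightarrow> eff_dom f \<noteq> {}"

definition error_function :: "('b \<times> 'b \<Rightarrow> ereal) \<Rightarrow> bool" where
  "error_function e \<longleftrightarrow>
     (\<forall>x y. 0 \<le> e (x, y)) \<and> (\<forall>x y. e (x, y) = e (y, x)) \<and> eff_dom e \<noteq> {}"

(* For f without the value -\<infinity> and nonnegative e, no sum below is of the form \<infinity> - \<infinity>. *)
definition e_convex :: "('a::real_vector \<times> 'a \<Rightarrow> ereal) \<Rightarrow> ('a \<Rightarrow> ereal) \<Rightarrow> bool" where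
  "e_convex e f \<longleftrightarrow>
     eff_dom f \<times> eff_dom f \<subseteq> eff_dom e \<and>
     (\<forall>x y. \<forall>t\<in>{0<..<1::real}.
        f (t *\<^sub>R x + (1 - t) *\<^sub>R y)
          \<le> ereal t * f x + ereal (1 - t) * f y + ereal (t * (1 - t)) * e (x, y))"

definition upper_dini :: "('a::real_vector \<Rightarrow> ereal) \<Rightarrow> 'a \<Rightarrow> 'a \<Rightarrow> ereal" where
  "upper_dini f x u =
     (if x \<in> eff_dom f
      then Limsup (at_right 0) (\<lambda>t::real. (f (x + t *\<^sub>R u) - f x) / ereal t)
      else -\<infinity>)"

(* Addition with \<infinity> + (-\<infinity>) = (-\<infinity>) + \<infinity> = -\<infinity>; the library's addition on ereal yields \<infinity> here. *)
definition lower_add :: "ereal \<Rightarrow> ereal \<Rightarrow> ereal"  (infixl "+\<^sub>l" 65) where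
  "a +\<^sub>l b = (if a = -\<infinity> \<or> b = -\<infinity> then -\<infinity> else a + b)"

end

theory Submission
  imports Defs
begin

(* Dividing the convexity inequality along the segment from x to y by t bounds the difference
   quotient by f y - f x + (1 - t) e (x, y).  In the sum of the two resulting bounds on the Dini
   derivatives, the differences of f cancel and 2 e (x, y) remains. *)

lemma upper_dini_le:
  fixes x y :: "'a::real_vector"
  assumes conv: "e_convex e f"
    and not_MInf: "\<And>z. f z \<noteq> -\<infinity>"
    and fx: "f x = ereal a" and fy: "f y = ereal b"
    and exy: "e (y, x) = ereal c" and c: "0 \<le> c"
  shows "upper_dini f x (y - x) \<le> ereal (b - a + c)"
proof -
  have quot: "(f (x + t *\<^sub>R (y - x)) - f x) / ereal t \<le> ereal (b - a + c)"
    if t: "0 < t" "t < 1" for t :: real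
  proof -
    \<comment> \<open>The weight \<open>t\<close> goes to \<open>y\<close>, so that the convex
      combination is the point at parameter \<open>t\<close> on the way from \<open>x\<close> to
      \<open>y\<close>.\<close>
    have "f (t *\<^sub>R y + (1 - t) *\<^sub>R x)
        \<le> ereal t * f y + ereal (1 - t) * f x + ereal (t * (1 - t)) * e (y, x)"
      using conv t unfolding e_convex_def by simp
    moreover have "t *\<^sub>R y + (1 - t) *\<^sub>R x = x + t *\<^sub>R (y - x)"
      by (simp add: algebra_simps)
    ultimately have le: "f (x + t *\<^sub>R (y - x)) \<le> ereal (t * b + (1 - t) * a + t * (1 - t) * c)"
      by (simp add: fx fy exy)
    \<comment> \<open>The real upper bound rules out \<infinity> and \<open>not_MInf\<close> rules
      out -\<infinity>, so the rest is real arithmetic.\<close>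
    then obtain r where r: "f (x + t *\<^sub>R (y - x)) = ereal r"
      using not_MInf by (cases "f (x + t *\<^sub>R (y - x))") auto
    have "r - a \<le> t * (b - a + (1 - t) * c)"
      using le r by (simp add: algebra_simps)
    \<comment> \<open>Since \<open>c\<close> is nonnegative, replacing \<open>1 - t\<close> by 1
      gives a bound free of \<open>t\<close>; it then bounds the \<open>Limsup\<close> with no limit
      to compute.\<close>
    also have "\<dots> \<le> t * (b - a + c)"
      using t c by (intro mult_left_mono) (auto simp: mult_left_le_one_le)
    finally have "(r - a) / t \<le> b - a + c"
      using t by (simp add: pos_divide_le_eq mult.commute)
    then show ?thesis
      using t by (simp add: r fx)
  qed
  have "\<forall>\<^sub>F t in at_right (0::real). 0 < t \<and> t < 1"
    by (auto simp: eventually_at_right[of 0 1] intro!: exI[of _ 1])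
  then have "Limsup (at_right 0) (\<lambda>t. (f (x + t *\<^sub>R (y - x)) - f x) / ereal t) \<le> ereal (b - a + c)"
    by (intro Limsup_bounded) (auto elim!: eventually_mono intro: quot)
  then show ?thesis
    by (simp add: upper_dini_def eff_dom_def fx)
qed

theorem proposition6:
  fixes e :: "'a::{topological_real_vector, t2_space} \<times> 'a \<Rightarrow> ereal"
    and f :: "'a \<Rightarrow> ereal"
  assumes "locally convex (UNIV :: 'a set)"
    and "error_function e"
    and "\<And>x. f x \<noteq> -\<infinity>"
    and "proper f"
    and "e_convex e f"
  shows "\<forall>x y. upper_dini f x (y - x) +\<^sub>l upper_dini f y (x - y) \<le> 2 * e (x, y)"
proof (intro allI)
  fix x y
  show "upper_dini f x (y - x) +\<^sub>l upper_dini f y (x - y) \<le> 2 * e (x, y)"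
  proof (cases "x \<in> eff_dom f \<and> y \<in> eff_dom f")
    \<comment> \<open>One of the derivatives is -\<infinity> by definition, and
      \<open>+\<^sub>l\<close> lets -\<infinity> win even against \<infinity>.\<close>
    case False
    then show ?thesis
      by (auto simp: upper_dini_def lower_add_def)
  next
    case True
    then obtain a b where ab: "f x = ereal a" "f y = ereal b"
      using assms(3)[of x] assms(3)[of y] unfolding eff_dom_def
      by (cases "f x"; cases "f y") auto
    \<comment> \<open>The domain inclusion in \<open>e_convex\<close> is what makes
      \<open>e (x, y)\<close> finite.\<close>
    have "(x, y) \<in> eff_dom e"
      using True assms(5) unfolding e_convex_def by auto
    moreover have nonneg: "0 \<le> e (x, y)" and sym: "e (y, x) = e (x, y)"
      using assms(2) unfolding error_function_def by blast+
    ultimately obtain c where c: "e (x, y) = ereal c" "0 \<le> c"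
      unfolding eff_dom_def by (cases "e (x, y)") auto
    \<comment> \<open>The lemma bounds this derivative through \<open>e (y, x)\<close>; symmetry
      turns it into the same \<open>c\<close> as in the opposite direction.\<close>
    have "upper_dini f x (y - x) \<le> ereal (b - a + c)"
      using ab c sym by (intro upper_dini_le[OF assms(5,3)]) auto
    moreover have "upper_dini f y (x - y) \<le> ereal (a - b + c)"
      using ab c by (intro upper_dini_le[OF assms(5,3)]) auto
    ultimately have "upper_dini f x (y - x) + upper_dini f y (x - y)
        \<le> ereal (b - a + c) + ereal (a - b + c)"
      by (rule add_mono)
    also have "\<dots> = 2 * e (x, y)"
      by (simp add: c)
    \<comment> \<open>\<open>+\<^sub>l\<close> is either -\<infinity> or the ordinary sum, so the
      bound carries over.\<close>
    finally show ?thesis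
      by (simp add: lower_add_def)
  qed
qed

end
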